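(* Let $\mathfrak{g}_0$ be a Lie algebra over $\mathbb{K}$ and $\mathfrak{g}_1$ a $\mathbb{K}$-vector space. Representations of $\mathfrak{g}_0$ in $\mathfrak{g}_1$ and diolic Lie algebra structures over $\mathfrak{g}_0$ (i.e. on $\mathfrak{g}_0\oplus\mathfrak{g}_1$, extending the given Lie bracket of $\mathfrak{g}_0$) are in one-to-one correspondence.
   Context: $\mathbb{K}$ is a field of characteristic $0$. A (truncated) diolic Lie algebra is a graded $\mathbb{K}$-vector space $\mathfrak{g}=\mathfrak{g}_0\oplus\mathfrak{g}_1$ with a Lie bracket $[\cdot,\cdot]$ (a skew-symmetric bilinear operation satisfying the Jacobi identity) such that $[\mathfrak{g}_0,\mathfrak{g}_0]\subseteq\mathfrak{g}_0$, $[\mathfrak{g}_0,\mathfrak{g}_1]\subseteq\mathfrak{g}_1$ and $[\mathfrak{g}_1,\mathfrak{g}_1]=0$. *)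

theory Defs
  imports "HOL-Analysis.Product_Vector"
begin

locale lie_algebra = vector_space scale
  for scale :: "'k::field_char_0 \<Rightarrow> 'g::ab_group_add \<Rightarrow> 'g" +
  fixes bracket :: "'g \<Rightarrow> 'g \<Rightarrow> 'g"
  assumes linear_left: "\<And>y. Vector_Spaces.linear scale scale (\<lambda>x. bracket x y)"
    and linear_right: "\<And>x. Vector_Spaces.linear scale scale (\<lambda>y. bracket x y)"
    and skew: "\<And>x y. bracket x y = - bracket y x"
    and jacobi: "\<And>x y z. bracket x (bracket y z) + bracket y (bracket z x) + bracket z (bracket x y) = 0"

(* The grading is an internal direct sum of the subspaces G0 (degree 0) and G1 (degree 1). *)
locale diolic_lie_algebra = lie_algebra scale bracket
  for scale :: "'k::field_char_0 \<Rightarrow> 'g::ab_group_add \<Rightarrow> 'g"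
    and bracket :: "'g \<Rightarrow> 'g \<Rightarrow> 'g" +
  fixes G0 G1 :: "'g set"
  assumes subspace_G0: "subspace G0"
    and subspace_G1: "subspace G1"
    and G0_Int_G1: "G0 \<inter> G1 = {0}"
    and G0_plus_G1: "{x + y | x y. x \<in> G0 \<and> y \<in> G1} = UNIV"
    and bracket_00: "\<And>x y. x \<in> G0 \<Longrightarrow> y \<in> G0 \<Longrightarrow> bracket x y \<in> G0"
    and bracket_01: "\<And>x y. x \<in> G0 \<Longrightarrow> y \<in> G1 \<Longrightarrow> bracket x y \<in> G1"
    and bracket_11: "\<And>x y. x \<in> G1 \<Longrightarrow> y \<in> G1 \<Longrightarrow> bracket x y = 0"

(* A Lie algebra homomorphism from the Lie algebra (scale0, bracket0) to gl(V), where V is the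
   vector space (scale1) and gl(V) carries the commutator bracket. Operations on gl(V) are
   written out pointwise. *)
locale lie_representation =
  lie_algebra scale0 bracket0 + V: vector_space scale1
  for scale0 :: "'k::field_char_0 \<Rightarrow> 'g::ab_group_add \<Rightarrow> 'g"
    and bracket0 :: "'g \<Rightarrow> 'g \<Rightarrow> 'g"
    and scale1 :: "'k \<Rightarrow> 'v::ab_group_add \<Rightarrow> 'v" +
  fixes \<rho> :: "'g \<Rightarrow> 'v \<Rightarrow> 'v"
  assumes endomorphism: "\<And>x. Vector_Spaces.linear scale1 scale1 (\<rho> x)"
    and linear_in_g: "\<And>v. Vector_Spaces.linear scale0 scale1 (\<lambda>x. \<rho> x v)"
    and hom_bracket: "\<And>x y v. \<rho> (bracket0 x y) v = \<rho> x (\<rho> y v) - \<rho> y (\<rho> x v)"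

(* The direct sum of the two spaces is the product type with componentwise operations;
   its homogeneous components are the two coordinate subspaces. *)
definition diolic_structure_over ::
    "('k::field_char_0 \<Rightarrow> 'g::ab_group_add \<Rightarrow> 'g) \<Rightarrow> ('g \<Rightarrow> 'g \<Rightarrow> 'g) \<Rightarrow>
     ('k \<Rightarrow> 'v::ab_group_add \<Rightarrow> 'v) \<Rightarrow> ('g \<times> 'v \<Rightarrow> 'g \<times> 'v \<Rightarrow> 'g \<times> 'v) \<Rightarrow> bool"
  where "diolic_structure_over scale0 bracket0 scale1 B \<longleftrightarrow>
    diolic_lie_algebra (module_prod.scale scale0 scale1) B (UNIV \<times> {0}) ({0} \<times> UNIV) \<and>
    (\<forall>x y. B (x, 0) (y, 0) = (bracket0 x y, 0))"

(* The action x.v = [x, v] of degree 0 on degree 1. For a diolic structure [x, v] lies in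
   degree 1, so taking the second component loses nothing. *)
definition induced_action ::
    "('g::zero \<times> 'v::zero \<Rightarrow> 'g \<times> 'v \<Rightarrow> 'g \<times> 'v) \<Rightarrow> 'g \<Rightarrow> 'v \<Rightarrow> 'v"
  where "induced_action B x v = snd (B (x, 0) (0, v))"

end

theory Submission
  imports Defs
begin

text \<open>
  The correspondence holds because the grading leaves a diolic bracket no freedom except in the
  mixed component. Write an element of the direct sum as \<open>(x, v) = (x, 0) + (0, v)\<close>. By
  bilinearity the bracket is determined by its values on homogeneous elements: in degrees
  \<open>(0, 0)\<close> it is the given bracket, in degrees \<open>(1, 1)\<close> it vanishes, and skew symmetry turns
  the degrees \<open>(1, 0)\<close> into the degrees \<open>(0, 1)\<close>, where the bracket is the induced action
  \<open>\<rho>\<close>. Hence every diolic bracket is the semidirect product bracket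
  \<open>[(x, v), (y, w)] = ([x, y], \<rho> x w - \<rho> y v)\<close> (lemma \<open>diolic_bracket_eq_semidirect\<close>), so
  that \<open>\<rho> \<mapsto> semidirect_bracket bracket0 \<rho>\<close> is the inverse map.

  What remains is that the two classes of objects correspond. The Jacobi identity for the
  semidirect bracket is trilinear. On three elements of degree 0 it is the Jacobi identity of
  the given Lie algebra; on two elements of degree 0 and one of degree 1 it says exactly that
  \<open>\<rho>\<close> respects brackets; with at least two elements of degree 1 every term vanishes. Read in
  one direction this makes the induced action a representation
  (lemma \<open>lie_representation_induced_action\<close>), read in the other it makes the semidirect
  bracket a Lie bracket (lemma \<open>diolic_structure_over_semidirect\<close>).
\<close>

definition semidirect_bracket ::
    "('g \<Rightarrow> 'g \<Rightarrow> 'g) \<Rightarrow> ('g \<Rightarrow> 'v \<Rightarrow> 'v::ab_group_add) \<Rightarrow> 'g \<times> 'v \<Rightarrow> 'g \<times> 'v \<Rightarrow> 'g \<times> 'v"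
  where "semidirect_bracket bracket0 \<rho> p q =
    (bracket0 (fst p) (fst q), \<rho> (fst p) (snd q) - \<rho> (fst q) (snd p))"

lemma semidirect_bracket_Pair [simp]:
  "semidirect_bracket bracket0 \<rho> (x, v) (y, w) = (bracket0 x y, \<rho> x w - \<rho> y v)"
  by (simp add: semidirect_bracket_def)

lemma (in lie_algebra)
  shows bracket_add_left: "bracket (x + y) z = bracket x z + bracket y z"
    and bracket_add_right: "bracket x (y + z) = bracket x y + bracket x z"
    and bracket_scale_left: "bracket (scale c x) y = scale c (bracket x y)"
    and bracket_scale_right: "bracket x (scale c y) = scale c (bracket x y)"
  using linear_left linear_right by (simp_all add: Vector_Spaces.linear_iff)

lemma (in lie_algebra) bracket_zero_right: "bracket x 0 = 0"
  using bracket_add_right[of x 0 0] by simp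

lemma (in lie_representation)
  shows action_add: "\<rho> x (v + w) = \<rho> x v + \<rho> x w"
    and action_scale: "\<rho> x (scale1 c v) = scale1 c (\<rho> x v)"
    and action_add_left: "\<rho> (x + y) v = \<rho> x v + \<rho> y v"
    and action_scale_left: "\<rho> (scale0 c x) v = scale1 c (\<rho> x v)"
  using endomorphism linear_in_g by (simp_all add: Vector_Spaces.linear_iff)

lemma (in lie_representation)
  shows action_zero: "\<rho> x 0 = 0"
    and action_zero_left: "\<rho> 0 v = 0"
    and action_diff: "\<rho> x (v - w) = \<rho> x v - \<rho> x w"
proof -
  show "\<rho> x 0 = 0" using action_add[of x 0 0] by simp
  show "\<rho> 0 v = 0" using action_add_left[of 0 0 v] by simp
  show "\<rho> x (v - w) = \<rho> x v - \<rho> x w" using action_add[of x "v - w" w] by simp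
qed

lemma induced_action_semidirect:
  assumes "lie_representation scale0 bracket0 scale1 \<rho>"
  shows "induced_action (semidirect_bracket bracket0 \<rho>) = \<rho>"
proof -
  interpret lie_representation scale0 bracket0 scale1 \<rho> by fact
  show ?thesis
    by (simp add: fun_eq_iff induced_action_def action_zero)
qed

text \<open>
  The bracket has degree 0, so the first component that \<open>induced_action\<close> discards is zero.
\<close>

lemma diolic_bracket_01:
  assumes "diolic_structure_over scale0 bracket0 scale1 B"
  shows "B (x, 0) (0, v) = (0, induced_action B x v)"
proof -
  interpret diolic_lie_algebra "module_prod.scale scale0 scale1" B "UNIV \<times> {0}" "{0} \<times> UNIV"
    using assms by (simp add: diolic_structure_over_def)
  have "B (x, 0) (0, v) \<in> {0} \<times> UNIV"
    by (rule bracket_01) auto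
  then show ?thesis
    by (auto simp: induced_action_def)
qed

lemma diolic_bracket_eq_semidirect:
  assumes "diolic_structure_over scale0 bracket0 scale1 B"
  shows "B = semidirect_bracket bracket0 (induced_action B)"
proof (rule ext, rule ext)
  fix p q :: "'b \<times> 'c"
  interpret diolic_lie_algebra "module_prod.scale scale0 scale1" B "UNIV \<times> {0}" "{0} \<times> UNIV"
    using assms by (simp add: diolic_structure_over_def)
  obtain x v where p: "p = (x, v)" by (cases p)
  obtain y w where q: "q = (y, w)" by (cases q)
  have "B p q = B ((x, 0) + (0, v)) ((y, 0) + (0, w))"
    by (simp add: p q)
  also have "\<dots> = B (x, 0) (y, 0) + B (x, 0) (0, w) + (B (0, v) (y, 0) + B (0, v) (0, w))"
    by (simp only: bracket_add_left bracket_add_right ac_simps)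
  also have "B (x, 0) (y, 0) = (bracket0 x y, 0)"
    using assms by (simp add: diolic_structure_over_def)
  also have "B (x, 0) (0, w) = (0, induced_action B x w)"
    by (rule diolic_bracket_01[OF assms])
  also have "B (0, v) (y, 0) = - (0, induced_action B y v)"
    by (subst skew) (simp only: diolic_bracket_01[OF assms])
  also have "B (0, v) (0, w) = 0"
    by (rule bracket_11) auto
  finally show "B p q = semidirect_bracket bracket0 (induced_action B) p q"
    by (simp add: p q)
qed

text \<open>
  Compatibility with brackets is the Jacobi identity on \<open>(x, 0)\<close>, \<open>(y, 0)\<close>, \<open>(0, v)\<close>,
  read off in degree 1. Its middle term is \<open>[y, [v, x]] = - [y, [x, v]]\<close> and its last one
  is \<open>[v, [x, y]] = - [[x, y], v]\<close>, which supplies the signs of a commutator.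
\<close>

lemma lie_representation_induced_action:
  fixes scale0 :: "'k::field_char_0 \<Rightarrow> 'g::ab_group_add \<Rightarrow> 'g"
    and scale1 :: "'k \<Rightarrow> 'v::ab_group_add \<Rightarrow> 'v"
  assumes "lie_algebra scale0 bracket0"
    and "vector_space scale1"
    and B: "diolic_structure_over scale0 bracket0 scale1 B"
  shows "lie_representation scale0 bracket0 scale1 (induced_action B)"
proof -
  interpret g: lie_algebra scale0 bracket0 by fact
  interpret V: vector_space scale1 by fact
  interpret vector_space_prod scale0 scale1 ..
  interpret d: diolic_lie_algebra scale B "UNIV \<times> {0}" "{0} \<times> UNIV"
    using B by (simp add: diolic_structure_over_def)
  let ?\<rho> = "induced_action B"
  note B01 = diolic_bracket_01[OF B]
  have add: "?\<rho> x (v + w) = ?\<rho> x v + ?\<rho> x w" for x v w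
    using d.bracket_add_right[of "(x, 0)" "(0, v)" "(0, w)"] by (simp add: B01)
  have scale_right: "?\<rho> x (scale1 c v) = scale1 c (?\<rho> x v)" for x c v
    using d.bracket_scale_right[of "(x, 0)" c "(0, v)"] by (simp add: B01 scale_prod)
  have add_left: "?\<rho> (x + y) v = ?\<rho> x v + ?\<rho> y v" for x y v
    using d.bracket_add_left[of "(x, 0)" "(y, 0)" "(0, v)"] by (simp add: B01)
  have scale_left: "?\<rho> (scale0 c x) v = scale1 c (?\<rho> x v)" for c x v
    using d.bracket_scale_left[of c "(x, 0)" "(0, v)"] by (simp add: B01 scale_prod)
  have zero: "?\<rho> x 0 = 0" for x
    using add[of x 0 0] by simp
  have zero_left: "?\<rho> 0 v = 0" for v
    using add_left[of 0 0 v] by simp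
  have neg: "?\<rho> x (- v) = - ?\<rho> x v" for x v
    using add[of x v "- v"] by (simp add: zero minus_unique)
  have hom: "?\<rho> (bracket0 x y) v = ?\<rho> x (?\<rho> y v) - ?\<rho> y (?\<rho> x v)" for x y v
  proof -
    have B_eq: "B (a, u) (b, w) = (bracket0 a b, ?\<rho> a w - ?\<rho> b u)" for a b u w
      by (subst diolic_bracket_eq_semidirect[OF B]) simp
    have "?\<rho> x (?\<rho> y v) - ?\<rho> y (?\<rho> x v) - ?\<rho> (bracket0 x y) v = 0"
      using arg_cong[OF d.jacobi[of "(x, 0)" "(y, 0)" "(0, v)"], of snd]
      by (simp add: B_eq zero zero_left neg)
    then show ?thesis by simp
  qed
  show ?thesis
    by unfold_locales (simp_all add: add scale_right add_left scale_left hom)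
qed

text \<open>
  In degree 1 the Jacobi sum contains, for each of the three elements, its degree 1 part acted
  on by the degree 0 parts of the other two: once by the action of their bracket and once by
  the commutator of their actions, with opposite signs. These cancel because \<open>\<rho>\<close> is a
  homomorphism.
\<close>

lemma diolic_structure_over_semidirect:
  fixes scale0 :: "'k::field_char_0 \<Rightarrow> 'g::ab_group_add \<Rightarrow> 'g"
    and scale1 :: "'k \<Rightarrow> 'v::ab_group_add \<Rightarrow> 'v"
  assumes "lie_representation scale0 bracket0 scale1 \<rho>"
  shows "diolic_structure_over scale0 bracket0 scale1 (semidirect_bracket bracket0 \<rho>)"
proof -
  interpret lie_representation scale0 bracket0 scale1 \<rho> by fact
  interpret vector_space_prod scale0 scale1 ..
  let ?B = "semidirect_bracket bracket0 \<rho>"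
  have lin_left: "Vector_Spaces.linear scale scale (\<lambda>p. ?B p q)" for q
    unfolding Vector_Spaces.linear_iff using p.vector_space_axioms
    by (auto simp: scale_prod semidirect_bracket_def bracket_add_left bracket_scale_left
        action_add action_scale action_add_left action_scale_left V.scale_right_diff_distrib)
  have lin_right: "Vector_Spaces.linear scale scale (\<lambda>q. ?B p q)" for p
    unfolding Vector_Spaces.linear_iff using p.vector_space_axioms
    by (auto simp: scale_prod semidirect_bracket_def bracket_add_right bracket_scale_right
        action_add action_scale action_add_left action_scale_left V.scale_right_diff_distrib)
  have skew_B: "?B p q = - ?B q p" for p q
    by (simp add: semidirect_bracket_def skew[of "fst p"])
  have jacobi_B: "?B p (?B q r) + ?B q (?B r p) + ?B r (?B p q) = 0" for p q r
    by (simp add: semidirect_bracket_def prod_eq_iff jacobi action_diff hom_bracket)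
  have "{a + b | a b. a \<in> UNIV \<times> {0} \<and> b \<in> {0} \<times> UNIV} = (UNIV :: ('g \<times> 'v) set)"
  proof (rule UNIV_eq_I[symmetric])
    fix p :: "'g \<times> 'v"
    have "p = (fst p, 0) + (0, snd p)" by simp
    then show "p \<in> {a + b | a b. a \<in> UNIV \<times> {0} \<and> b \<in> {0} \<times> UNIV}" by blast
  qed
  moreover have "lie_algebra scale ?B"
    using lin_left lin_right skew_B jacobi_B
    by (intro lie_algebra.intro p.vector_space_axioms lie_algebra_axioms.intro)
  ultimately have "diolic_lie_algebra scale ?B (UNIV \<times> {0}) ({0} \<times> UNIV)"
    by (intro diolic_lie_algebra.intro diolic_lie_algebra_axioms.intro)
      (auto simp: subspace_Times action_zero action_zero_left bracket_zero_right zero_prod_def)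
  then show ?thesis
    by (simp add: diolic_structure_over_def action_zero)
qed

theorem lemma10:
  fixes scale0 :: "'k::field_char_0 \<Rightarrow> 'g::ab_group_add \<Rightarrow> 'g"
    and bracket0 :: "'g \<Rightarrow> 'g \<Rightarrow> 'g"
    and scale1 :: "'k \<Rightarrow> 'v::ab_group_add \<Rightarrow> 'v"
  assumes "lie_algebra scale0 bracket0"
    and "vector_space scale1"
  shows "bij_betw induced_action
    {B. diolic_structure_over scale0 bracket0 scale1 B}
    {\<rho>. lie_representation scale0 bracket0 scale1 \<rho>}"
proof (rule bij_betw_byWitness[where f' = "semidirect_bracket bracket0"])
  show "\<forall>B \<in> {B. diolic_structure_over scale0 bracket0 scale1 B}.
      semidirect_bracket bracket0 (induced_action B) = B"
    using diolic_bracket_eq_semidirect by (metis mem_Collect_eq)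
  show "\<forall>\<rho> \<in> {\<rho>. lie_representation scale0 bracket0 scale1 \<rho>}.
      induced_action (semidirect_bracket bracket0 \<rho>) = \<rho>"
    by (auto intro: induced_action_semidirect)
  show "induced_action ` {B. diolic_structure_over scale0 bracket0 scale1 B}
      \<subseteq> {\<rho>. lie_representation scale0 bracket0 scale1 \<rho>}"
    using lie_representation_induced_action[OF assms] by auto
  show "semidirect_bracket bracket0 ` {\<rho>. lie_representation scale0 bracket0 scale1 \<rho>}
      \<subseteq> {B. diolic_structure_over scale0 bracket0 scale1 B}"
    using diolic_structure_over_semidirect by auto
qed

end
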